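(* Let $\mathcal{C}$ be an S-positive subcategory of a quantum CD category, and let $\mathcal{M}$ be the subcategory of even morphisms of that quantum CD category. Let $p:I\to X$ and $f:X\to Y$ be unital morphisms in $\mathcal{M}$ and set $q:=f\circ p$. i. If $f$ is invertible, with inverse in $\mathcal{M}$, then $f^{-1}$ is a disintegration of $(f,p,q)$ in $\mathcal{M}$. ii. Assume that $f$ and $p$ are in $\mathcal{C}$. If $f$ is invertible, with inverse also in $\mathcal{C}$, then $f^{-1}$ is a Bayesian inverse of $(f,p,q)$.
   Context: A $\mathbb{Z}_2$-monoidal category is a category in which every morphism has a grade in $\mathbb{Z}_2=\{0,1\}$ ($0$ = even, $1$ = odd), identities being even and grades adding under composition, such that for each object $X$ and each grade there is an isomorphism with source $X$ of that grade; together with a tensor product assigning $X\otimes Y$ to objects and $f\otimes f'$ (of the common grade) to pairs of morphisms of equal grade, functorially; a unit object $I$ with a chosen odd involution $*_I$ of $I$; and even natural isomorphisms (associator, symmetry $c_{X,Y}:X\otimes Y\to Y\otimes X$, unitor $I\otimes X\to X$) satisfying the usual axioms of a symmetric monoidal category. Associators and unitors are suppressed. A quantum CD category is a $\mathbb{Z}_2$-monoidal category with, for each object $X$, even morphisms $\Delta_X:X\to X\otimes X$, $!_X:X\to I$ and an odd morphism $*_X:X\to X$ such that: $(!_X\otimes\mathrm{id})\Delta_X=\mathrm{id}_X=(\mathrm{id}\otimes{!_X})\Delta_X$; $(\Delta_X\otimes\mathrm{id})\Delta_X=(\mathrm{id}\otimes\Delta_X)\Delta_X$; $c_{X,X}(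 *_X\otimes*_X)\Delta_X=\Delta_X*_X$; $!_{X\otimes Y}={!_X}\otimes{!_Y}$; $!_I=\mathrm{id}_I$; $\Delta_{X\otimes Y}=(\mathrm{id}_X\otimes c_{X,Y}\otimes\mathrm{id}_Y)(\Delta_X\otimes\Delta_Y)$; $\Delta_I=\mathrm{id}_I$; $*_X*_X=\mathrm{id}_X$; $*_{X\otimes Y}=*_X\otimes*_Y$; $!_X*_X=*_I\,!_X$. An even morphism $f:X\to Y$ is unital if $!_Yf={!_X}$. A morphism $f:X\to Y$ is $*$-preserving if $f*_X=*_Yf$. An even $f:X\to Y$ is deterministic if it is $*$-preserving and $\Delta_Yf=(f\otimes f)\Delta_X$. A subcategory $\mathcal{C}$ consisting of even morphisms is S-positive if for every composable pair $X\xrightarrow{f}Y\xrightarrow{g}Z$ in $\mathcal{C}$ with $gf$ deterministic, $(g\otimes\mathrm{id}_Y)\Delta_Yf=((gf)\otimes f)\Delta_X$. Given $p:I\to X$, $q:I\to Y$, $f:X\to Y$ with $fp=q$: a disintegration of $(f,p,q)$ in $\mathcal{M}$ is a $g:Y\to X$ in $\mathcal{M}$ with $gq=p$ and $(\mathrm{id}_Y\otimes(fg))\Delta_Yq=\Delta_Yq$. A Bayesian inverse of $(f,p,q)$ is a $g:Y\to X$ in $\mathcal{C}$ with $(g\otimes\mathrm{id}_Y)\Delta_Yq=(\mathrm{id}_X\otimes f)\Delta_Xp$. *)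

theory Defs
  imports Main "HOL-Library.Z2"
begin

section \<open>Categories graded by the group of order two\<close>

text \<open>
  The grades are the elements of the two-element field \<open>bit\<close>: \<open>0\<close> is even, \<open>1\<close> is odd.
  Composition is written in the usual order: \<open>g \<cdot> f\<close> is \<open>f\<close> followed by \<open>g\<close>.
  All operations are total functions, constrained only on the arguments on which they
  are meaningful: \<open>cmp\<close> on composable pairs, \<open>tensor\<close> on pairs of morphisms of equal grade.
\<close>

record ('o, 'm) graded_cat =
  Obj    :: "'o set"
  Mor    :: "'m set"
  source :: "'m \<Rightarrow> 'o"
  target :: "'m \<Rightarrow> 'o"
  grade  :: "'m \<Rightarrow> bit"
  ident  :: "'o \<Rightarrow> 'm"  ("\<iota>\<index>")
  cmp    :: "'m \<Rightarrow> 'm \<Rightarrow> 'm"  (infixl "\<cdot>\<index>" 70)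

definition hom :: "('o, 'm, 'z) graded_cat_scheme \<Rightarrow> 'o \<Rightarrow> 'o \<Rightarrow> 'm set" where
  "hom Q X Y = {f \<in> Mor Q. source Q f = X \<and> target Q f = Y}"

definition ehom :: "('o, 'm, 'z) graded_cat_scheme \<Rightarrow> 'o \<Rightarrow> 'o \<Rightarrow> 'm set" where
  "ehom Q X Y = {f \<in> hom Q X Y. grade Q f = 0}"

definition is_inverse :: "('o, 'm, 'z) graded_cat_scheme \<Rightarrow> 'm \<Rightarrow> 'm \<Rightarrow> bool" where
  "is_inverse Q f g \<longleftrightarrow>
     f \<in> Mor Q \<and> g \<in> hom Q (target Q f) (source Q f) \<and>
     g \<cdot>\<^bsub>Q\<^esub> f = \<iota>\<^bsub>Q\<^esub> (source Q f) \<and> f \<cdot>\<^bsub>Q\<^esub> g = \<iota>\<^bsub>Q\<^esub> (target Q f)"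

definition invertible :: "('o, 'm, 'z) graded_cat_scheme \<Rightarrow> 'm \<Rightarrow> bool" where
  "invertible Q f \<longleftrightarrow> (\<exists>g. is_inverse Q f g)"

definition inverse_mor :: "('o, 'm, 'z) graded_cat_scheme \<Rightarrow> 'm \<Rightarrow> 'm" where
  "inverse_mor Q f = (THE g. is_inverse Q f g)"

locale graded_category =
  fixes Q :: "('o, 'm, 'z) graded_cat_scheme" (structure)
  assumes source_in: "f \<in> Mor Q \<Longrightarrow> source Q f \<in> Obj Q"
    and target_in: "f \<in> Mor Q \<Longrightarrow> target Q f \<in> Obj Q"
    and ident_in: "X \<in> Obj Q \<Longrightarrow> \<iota> X \<in> ehom Q X X"
    and cmp_in: "\<lbrakk>f \<in> hom Q X Y; g \<in> hom Q Y Z\<rbrakk> \<Longrightarrow> g \<cdot> f \<in> hom Q X Z"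
    and cmp_ident_left: "f \<in> hom Q X Y \<Longrightarrow> \<iota> Y \<cdot> f = f"
    and cmp_ident_right: "f \<in> hom Q X Y \<Longrightarrow> f \<cdot> \<iota> X = f"
    and cmp_assoc: "\<lbrakk>f \<in> hom Q W X; g \<in> hom Q X Y; h \<in> hom Q Y Z\<rbrakk>
                    \<Longrightarrow> (h \<cdot> g) \<cdot> f = h \<cdot> (g \<cdot> f)"
    and grade_cmp: "\<lbrakk>f \<in> hom Q X Y; g \<in> hom Q Y Z\<rbrakk> \<Longrightarrow> grade Q (g \<cdot> f) = grade Q g + grade Q f"
    and iso_of_each_grade: "X \<in> Obj Q
          \<Longrightarrow> \<exists>f\<in>Mor Q. source Q f = X \<and> grade Q f = d \<and> invertible Q f"

section \<open>Monoidal structure\<close>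

record ('o, 'm) graded_moncat = "('o, 'm) graded_cat" +
  tensor_obj :: "'o \<Rightarrow> 'o \<Rightarrow> 'o"  (infixl "\<odot>\<index>" 75)
  tensor     :: "'m \<Rightarrow> 'm \<Rightarrow> 'm"  (infixl "\<otimes>\<index>" 75)
  unit_obj   :: "'o"  ("\<I>\<index>")
  unit_star  :: "'m"  ("*\<^sub>I\<index>")
  assoc      :: "'o \<Rightarrow> 'o \<Rightarrow> 'o \<Rightarrow> 'm"  ("\<alpha>\<index>")
  unitor     :: "'o \<Rightarrow> 'm"  ("\<lambda>\<^sub>I\<index>")
  symm       :: "'o \<Rightarrow> 'o \<Rightarrow> 'm"  ("\<sigma>\<index>")

text \<open>
  The identity and the chosen odd involution of the unit object make up a
  grade-preserving functor from the group of grades; its value at a grade is what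
  gets tensored with a morphism of that grade in the naturality of the unitor.
\<close>

definition unit_mor :: "('o, 'm, 'z) graded_moncat_scheme \<Rightarrow> bit \<Rightarrow> 'm" where
  "unit_mor Q d = (if d = 0 then \<iota>\<^bsub>Q\<^esub> \<I>\<^bsub>Q\<^esub> else *\<^sub>I\<^bsub>Q\<^esub>)"

text \<open>The unitor is the one for \<open>I \<otimes> X \<rightarrow> X\<close>; the one for \<open>X \<otimes> I \<rightarrow> X\<close> is obtained by symmetry.\<close>

definition runitor :: "('o, 'm, 'z) graded_moncat_scheme \<Rightarrow> 'o \<Rightarrow> 'm" where
  "runitor Q X = \<lambda>\<^sub>I\<^bsub>Q\<^esub> X \<cdot>\<^bsub>Q\<^esub> \<sigma>\<^bsub>Q\<^esub> X \<I>\<^bsub>Q\<^esub>"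

locale Z2_monoidal_category = graded_category Q
  for Q :: "('o, 'm, 'z) graded_moncat_scheme" (structure) +
  assumes tensor_obj_in: "\<lbrakk>X \<in> Obj Q; Y \<in> Obj Q\<rbrakk> \<Longrightarrow> X \<odot> Y \<in> Obj Q"
    and tensor_in: "\<lbrakk>f \<in> hom Q X Y; f' \<in> hom Q X' Y'; grade Q f = grade Q f'\<rbrakk>
          \<Longrightarrow> f \<otimes> f' \<in> hom Q (X \<odot> X') (Y \<odot> Y')"
    and grade_tensor: "\<lbrakk>f \<in> Mor Q; f' \<in> Mor Q; grade Q f = grade Q f'\<rbrakk>
          \<Longrightarrow> grade Q (f \<otimes> f') = grade Q f"
    and tensor_ident: "\<lbrakk>X \<in> Obj Q; Y \<in> Obj Q\<rbrakk> \<Longrightarrow> \<iota> X \<otimes> \<iota> Y = \<iota> (X \<odot> Y)"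
    and tensor_cmp: "\<lbrakk>f \<in> hom Q X Y; g \<in> hom Q Y Z; f' \<in> hom Q X' Y'; g' \<in> hom Q Y' Z';
                      grade Q f = grade Q f'; grade Q g = grade Q g'\<rbrakk>
          \<Longrightarrow> (g \<cdot> f) \<otimes> (g' \<cdot> f') = (g \<otimes> g') \<cdot> (f \<otimes> f')"
    and unit_obj_in: "\<I> \<in> Obj Q"
    and unit_star_in: "*\<^sub>I \<in> hom Q \<I> \<I>"
    and unit_star_odd: "grade Q *\<^sub>I = 1"
    and unit_star_involution: "*\<^sub>I \<cdot> *\<^sub>I = \<iota> \<I>"
    and assoc_in: "\<lbrakk>X \<in> Obj Q; Y \<in> Obj Q; Z \<in> Obj Q\<rbrakk>
          \<Longrightarrow> \<alpha> X Y Z \<in> ehom Q ((X \<odot> Y) \<odot> Z) (X \<odot> (Y \<odot> Z))"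
    and assoc_iso: "\<lbrakk>X \<in> Obj Q; Y \<in> Obj Q; Z \<in> Obj Q\<rbrakk> \<Longrightarrow> invertible Q (\<alpha> X Y Z)"
    and assoc_natural: "\<lbrakk>f \<in> hom Q X X'; g \<in> hom Q Y Y'; h \<in> hom Q Z Z';
                         grade Q f = grade Q g; grade Q g = grade Q h\<rbrakk>
          \<Longrightarrow> \<alpha> X' Y' Z' \<cdot> ((f \<otimes> g) \<otimes> h) = (f \<otimes> (g \<otimes> h)) \<cdot> \<alpha> X Y Z"
    and unitor_in: "X \<in> Obj Q \<Longrightarrow> \<lambda>\<^sub>I X \<in> ehom Q (\<I> \<odot> X) X"
    and unitor_iso: "X \<in> Obj Q \<Longrightarrow> invertible Q (\<lambda>\<^sub>I X)"
    and unitor_natural: "f \<in> hom Q X Y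
          \<Longrightarrow> \<lambda>\<^sub>I Y \<cdot> (unit_mor Q (grade Q f) \<otimes> f) = f \<cdot> \<lambda>\<^sub>I X"
    and symm_in: "\<lbrakk>X \<in> Obj Q; Y \<in> Obj Q\<rbrakk> \<Longrightarrow> \<sigma> X Y \<in> ehom Q (X \<odot> Y) (Y \<odot> X)"
    and symm_natural: "\<lbrakk>f \<in> hom Q X X'; g \<in> hom Q Y Y'; grade Q f = grade Q g\<rbrakk>
          \<Longrightarrow> \<sigma> X' Y' \<cdot> (f \<otimes> g) = (g \<otimes> f) \<cdot> \<sigma> X Y"
    and symm_symm: "\<lbrakk>X \<in> Obj Q; Y \<in> Obj Q\<rbrakk> \<Longrightarrow> \<sigma> Y X \<cdot> \<sigma> X Y = \<iota> (X \<odot> Y)"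
    and pentagon: "\<lbrakk>W \<in> Obj Q; X \<in> Obj Q; Y \<in> Obj Q; Z \<in> Obj Q\<rbrakk>
          \<Longrightarrow> \<alpha> W X (Y \<odot> Z) \<cdot> \<alpha> (W \<odot> X) Y Z
              = (\<iota> W \<otimes> \<alpha> X Y Z) \<cdot> \<alpha> W (X \<odot> Y) Z \<cdot> (\<alpha> W X Y \<otimes> \<iota> Z)"
    and triangle: "\<lbrakk>X \<in> Obj Q; Y \<in> Obj Q\<rbrakk>
          \<Longrightarrow> (\<iota> X \<otimes> \<lambda>\<^sub>I Y) \<cdot> \<alpha> X \<I> Y = runitor Q X \<otimes> \<iota> Y"
    and hexagon: "\<lbrakk>X \<in> Obj Q; Y \<in> Obj Q; Z \<in> Obj Q\<rbrakk>
          \<Longrightarrow> \<alpha> Y Z X \<cdot> \<sigma> X (Y \<odot> Z) \<cdot> \<alpha> X Y Z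
              = (\<iota> Y \<otimes> \<sigma> X Z) \<cdot> \<alpha> Y X Z \<cdot> (\<sigma> X Y \<otimes> \<iota> Z)"

section \<open>Quantum CD categories\<close>

record ('o, 'm) qcd_cat = "('o, 'm) graded_moncat" +
  copy    :: "'o \<Rightarrow> 'm"  ("\<Delta>\<index>")
  discard :: "'o \<Rightarrow> 'm"  ("\<epsilon>\<index>")
  star    :: "'o \<Rightarrow> 'm"  ("\<star>\<index>")

text \<open>
  The morphism written \<open>id \<otimes> c \<otimes> id\<close> when associators are suppressed:
  \<open>(X \<otimes> X) \<otimes> (Y \<otimes> Y) \<rightarrow> (X \<otimes> Y) \<otimes> (X \<otimes> Y)\<close>.
\<close>

definition middle_swap :: "('o, 'm, 'z) graded_moncat_scheme \<Rightarrow> 'o \<Rightarrow> 'o \<Rightarrow> 'm" where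
  "middle_swap Q X Y =
     inverse_mor Q (\<alpha>\<^bsub>Q\<^esub> X Y (X \<odot>\<^bsub>Q\<^esub> Y))
     \<cdot>\<^bsub>Q\<^esub> (\<iota>\<^bsub>Q\<^esub> X \<otimes>\<^bsub>Q\<^esub> (\<alpha>\<^bsub>Q\<^esub> Y X Y
           \<cdot>\<^bsub>Q\<^esub> (\<sigma>\<^bsub>Q\<^esub> X Y \<otimes>\<^bsub>Q\<^esub> \<iota>\<^bsub>Q\<^esub> Y)
           \<cdot>\<^bsub>Q\<^esub> inverse_mor Q (\<alpha>\<^bsub>Q\<^esub> X Y Y)))
     \<cdot>\<^bsub>Q\<^esub> \<alpha>\<^bsub>Q\<^esub> X X (Y \<odot>\<^bsub>Q\<^esub> Y)"

text \<open>
  Discarding is written \<open>\<epsilon>\<close>. Associators and unitors are inserted where they are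
  suppressed on paper. The axioms \<open>discard_star\<close> and \<open>discard_unit\<close> force \<open>star\<close> at the
  unit object to be the chosen involution.
\<close>

locale quantum_CD_category = Z2_monoidal_category Q
  for Q :: "('o, 'm, 'z) qcd_cat_scheme" (structure) +
  assumes copy_in: "X \<in> Obj Q \<Longrightarrow> \<Delta> X \<in> ehom Q X (X \<odot> X)"
    and discard_in: "X \<in> Obj Q \<Longrightarrow> \<epsilon> X \<in> ehom Q X \<I>"
    and star_in: "X \<in> Obj Q \<Longrightarrow> \<star> X \<in> hom Q X X"
    and star_odd: "X \<in> Obj Q \<Longrightarrow> grade Q (\<star> X) = 1"
    and counit_left: "X \<in> Obj Q \<Longrightarrow> \<lambda>\<^sub>I X \<cdot> (\<epsilon> X \<otimes> \<iota> X) \<cdot> \<Delta> X = \<iota> X"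
    and counit_right: "X \<in> Obj Q \<Longrightarrow> runitor Q X \<cdot> (\<iota> X \<otimes> \<epsilon> X) \<cdot> \<Delta> X = \<iota> X"
    and coassoc: "X \<in> Obj Q
          \<Longrightarrow> \<alpha> X X X \<cdot> (\<Delta> X \<otimes> \<iota> X) \<cdot> \<Delta> X = (\<iota> X \<otimes> \<Delta> X) \<cdot> \<Delta> X"
    and copy_star: "X \<in> Obj Q \<Longrightarrow> \<sigma> X X \<cdot> (\<star> X \<otimes> \<star> X) \<cdot> \<Delta> X = \<Delta> X \<cdot> \<star> X"
    and discard_tensor: "\<lbrakk>X \<in> Obj Q; Y \<in> Obj Q\<rbrakk>
          \<Longrightarrow> \<epsilon> (X \<odot> Y) = \<lambda>\<^sub>I \<I> \<cdot> (\<epsilon> X \<otimes> \<epsilon> Y)"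
    and discard_unit: "\<epsilon> \<I> = \<iota> \<I>"
    and copy_tensor: "\<lbrakk>X \<in> Obj Q; Y \<in> Obj Q\<rbrakk>
          \<Longrightarrow> \<Delta> (X \<odot> Y) = middle_swap Q X Y \<cdot> (\<Delta> X \<otimes> \<Delta> Y)"
    and copy_unit: "\<Delta> \<I> = inverse_mor Q (\<lambda>\<^sub>I \<I>)"
    and star_star: "X \<in> Obj Q \<Longrightarrow> \<star> X \<cdot> \<star> X = \<iota> X"
    and star_tensor: "\<lbrakk>X \<in> Obj Q; Y \<in> Obj Q\<rbrakk> \<Longrightarrow> \<star> (X \<odot> Y) = \<star> X \<otimes> \<star> Y"
    and discard_star: "X \<in> Obj Q \<Longrightarrow> \<epsilon> X \<cdot> \<star> X = *\<^sub>I \<cdot> \<epsilon> X"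

definition unital :: "('o, 'm, 'z) qcd_cat_scheme \<Rightarrow> 'm \<Rightarrow> bool" where
  "unital Q f \<longleftrightarrow> f \<in> Mor Q \<and> grade Q f = 0 \<and>
     \<epsilon>\<^bsub>Q\<^esub> (target Q f) \<cdot>\<^bsub>Q\<^esub> f = \<epsilon>\<^bsub>Q\<^esub> (source Q f)"

definition star_preserving :: "('o, 'm, 'z) qcd_cat_scheme \<Rightarrow> 'm \<Rightarrow> bool" where
  "star_preserving Q f \<longleftrightarrow> f \<in> Mor Q \<and>
     f \<cdot>\<^bsub>Q\<^esub> \<star>\<^bsub>Q\<^esub> (source Q f) = \<star>\<^bsub>Q\<^esub> (target Q f) \<cdot>\<^bsub>Q\<^esub> f"

definition deterministic :: "('o, 'm, 'z) qcd_cat_scheme \<Rightarrow> 'm \<Rightarrow> bool" where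
  "deterministic Q f \<longleftrightarrow> f \<in> Mor Q \<and> grade Q f = 0 \<and> star_preserving Q f \<and>
     \<Delta>\<^bsub>Q\<^esub> (target Q f) \<cdot>\<^bsub>Q\<^esub> f = (f \<otimes>\<^bsub>Q\<^esub> f) \<cdot>\<^bsub>Q\<^esub> \<Delta>\<^bsub>Q\<^esub> (source Q f)"

section \<open>Subcategories\<close>

record ('o, 'm) subcat =
  objs :: "'o set"
  mors :: "'m set"

definition subcategory :: "('o, 'm, 'z) graded_cat_scheme \<Rightarrow> ('o, 'm) subcat \<Rightarrow> bool" where
  "subcategory Q C \<longleftrightarrow>
     objs C \<subseteq> Obj Q \<and> mors C \<subseteq> Mor Q \<and>
     (\<forall>f\<in>mors C. source Q f \<in> objs C \<and> target Q f \<in> objs C) \<and>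
     (\<forall>X\<in>objs C. \<iota>\<^bsub>Q\<^esub> X \<in> mors C) \<and>
     (\<forall>f\<in>mors C. \<forall>g\<in>mors C. target Q f = source Q g \<longrightarrow> g \<cdot>\<^bsub>Q\<^esub> f \<in> mors C)"

definition even_subcat :: "('o, 'm, 'z) graded_cat_scheme \<Rightarrow> ('o, 'm) subcat" where
  "even_subcat Q = \<lparr>objs = Obj Q, mors = {f \<in> Mor Q. grade Q f = 0}\<rparr>"

text \<open>
  The morphisms \<open>g \<otimes> id\<close>, \<open>gf \<otimes> f\<close> and \<open>\<Delta>\<close> in this condition are formed in the ambient
  category; they need not belong to the subcategory.
\<close>

definition S_positive :: "('o, 'm, 'z) qcd_cat_scheme \<Rightarrow> ('o, 'm) subcat \<Rightarrow> bool" where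
  "S_positive Q C \<longleftrightarrow>
     subcategory Q C \<and> (\<forall>f\<in>mors C. grade Q f = 0) \<and>
     (\<forall>X Y Z f g. f \<in> mors C \<inter> hom Q X Y \<and> g \<in> mors C \<inter> hom Q Y Z \<and>
        deterministic Q (g \<cdot>\<^bsub>Q\<^esub> f) \<longrightarrow>
        (g \<otimes>\<^bsub>Q\<^esub> \<iota>\<^bsub>Q\<^esub> Y) \<cdot>\<^bsub>Q\<^esub> \<Delta>\<^bsub>Q\<^esub> Y \<cdot>\<^bsub>Q\<^esub> f
        = ((g \<cdot>\<^bsub>Q\<^esub> f) \<otimes>\<^bsub>Q\<^esub> f) \<cdot>\<^bsub>Q\<^esub> \<Delta>\<^bsub>Q\<^esub> X)"

section \<open>Disintegrations and Bayesian inverses\<close>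

definition state_preserving ::
    "('o, 'm, 'z) qcd_cat_scheme \<Rightarrow> 'o \<Rightarrow> 'o \<Rightarrow> 'm \<Rightarrow> 'm \<Rightarrow> 'm \<Rightarrow> bool" where
  "state_preserving Q X Y f p q \<longleftrightarrow>
     p \<in> ehom Q \<I>\<^bsub>Q\<^esub> X \<and> q \<in> ehom Q \<I>\<^bsub>Q\<^esub> Y \<and> f \<in> ehom Q X Y \<and> f \<cdot>\<^bsub>Q\<^esub> p = q"

definition disintegration ::
    "('o, 'm, 'z) qcd_cat_scheme \<Rightarrow> ('o, 'm) subcat \<Rightarrow> 'o \<Rightarrow> 'o \<Rightarrow> 'm \<Rightarrow> 'm \<Rightarrow> 'm \<Rightarrow> 'm \<Rightarrow> bool"
  where
  "disintegration Q M X Y f p q g \<longleftrightarrow>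
     state_preserving Q X Y f p q \<and> g \<in> mors M \<inter> hom Q Y X \<and>
     g \<cdot>\<^bsub>Q\<^esub> q = p \<and>
     (\<iota>\<^bsub>Q\<^esub> Y \<otimes>\<^bsub>Q\<^esub> (f \<cdot>\<^bsub>Q\<^esub> g)) \<cdot>\<^bsub>Q\<^esub> \<Delta>\<^bsub>Q\<^esub> Y \<cdot>\<^bsub>Q\<^esub> q = \<Delta>\<^bsub>Q\<^esub> Y \<cdot>\<^bsub>Q\<^esub> q"

definition bayesian_inverse ::
    "('o, 'm, 'z) qcd_cat_scheme \<Rightarrow> ('o, 'm) subcat \<Rightarrow> 'o \<Rightarrow> 'o \<Rightarrow> 'm \<Rightarrow> 'm \<Rightarrow> 'm \<Rightarrow> 'm \<Rightarrow> bool"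
  where
  "bayesian_inverse Q C X Y f p q g \<longleftrightarrow>
     state_preserving Q X Y f p q \<and> g \<in> mors C \<inter> hom Q Y X \<and>
     (g \<otimes>\<^bsub>Q\<^esub> \<iota>\<^bsub>Q\<^esub> Y) \<cdot>\<^bsub>Q\<^esub> \<Delta>\<^bsub>Q\<^esub> Y \<cdot>\<^bsub>Q\<^esub> q = (\<iota>\<^bsub>Q\<^esub> X \<otimes>\<^bsub>Q\<^esub> f) \<cdot>\<^bsub>Q\<^esub> \<Delta>\<^bsub>Q\<^esub> X \<cdot>\<^bsub>Q\<^esub> p"

end

theory Submission
  imports Defs
begin

text \<open>Write g for the inverse of f. Part i is pure cancellation: g q = g f p = p, and since f
  g is an identity, tensoring it with the identity of Y leaves the copied state unchanged. Part ii
  rests on S-positivity applied to the composable pair f, g. Their composite is an identity, which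
  is deterministic (\<open>deterministic_ident\<close>), so S-positivity yields the Bayesian
  equation as an equality of morphisms out of X (\<open>S_positive_inverse\<close>); precomposing
  with p gives the claim.\<close>

lemma (in graded_category) is_inverse_unique:
  assumes "is_inverse Q f g" and "is_inverse Q f h"
  shows "g = h"
proof -
  have f: "f \<in> hom Q (source Q f) (target Q f)"
    and g: "g \<in> hom Q (target Q f) (source Q f)"
    and h: "h \<in> hom Q (target Q f) (source Q f)"
    and gf: "g \<cdot> f = \<iota> (source Q f)" and fh: "f \<cdot> h = \<iota> (target Q f)"
    using assms by (auto simp: is_inverse_def hom_def)
  have "g = g \<cdot> (f \<cdot> h)"
    using cmp_ident_right[OF g] fh by simp
  also have "\<dots> = (g \<cdot> f) \<cdot> h"
    using cmp_assoc[OF h f g] by simp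
  also have "\<dots> = h"
    using cmp_ident_left[OF h] gf by simp
  finally show ?thesis .
qed

text \<open>Uniqueness of inverses makes the definite description in \<open>inverse_mor\<close>
  denote an actual inverse.\<close>

lemma (in graded_category) is_inverse_inverse_mor:
  assumes "invertible Q f"
  shows "is_inverse Q f (inverse_mor Q f)"
  unfolding inverse_mor_def
  by (rule theI') (use assms is_inverse_unique in \<open>auto simp: invertible_def\<close>)

lemma (in graded_category) inverse_mor:
  assumes "invertible Q f" and "f \<in> hom Q X Y"
  shows "inverse_mor Q f \<in> hom Q Y X"
    and "inverse_mor Q f \<cdot> f = \<iota> X" and "f \<cdot> inverse_mor Q f = \<iota> Y"
  using is_inverse_inverse_mor[OF assms(1)] assms(2) by (auto simp: is_inverse_def hom_def)

text \<open>Supplies the determinism premise of S-positivity for an inverse pair. Compatibility with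
  the star and with copying both reduce to the unit laws, once \<open>tensor_ident\<close> turns the
  tensor of two identities into an identity.\<close>

lemma (in quantum_CD_category) deterministic_ident:
  assumes X: "X \<in> Obj Q"
  shows "deterministic Q (\<iota> X)"
proof -
  have i: "\<iota> X \<in> Mor Q" "source Q (\<iota> X) = X" "target Q (\<iota> X) = X" "grade Q (\<iota> X) = 0"
    using ident_in[OF X] by (auto simp: ehom_def hom_def)
  have d: "\<Delta> X \<in> hom Q X (X \<odot> X)"
    using copy_in[OF X] by (simp add: ehom_def)
  show ?thesis
    using i X cmp_ident_left[OF d] cmp_ident_right[OF d]
      cmp_ident_left[OF star_in[OF X]] cmp_ident_right[OF star_in[OF X]]
    by (simp add: deterministic_def star_preserving_def tensor_ident)
qed

text \<open>Bayesian inversion before any state is inserted: in the S-positivity equation the factor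
  \<open>g \<cdot> f\<close> on the right collapses to an identity.\<close>

lemma (in quantum_CD_category) S_positive_inverse:
  assumes "S_positive Q C" and "f \<in> mors C" and "g \<in> mors C"
    and f: "f \<in> hom Q X Y" and g: "g \<in> hom Q Y X" and gf: "g \<cdot> f = \<iota> X"
  shows "(g \<otimes> \<iota> Y) \<cdot> \<Delta> Y \<cdot> f = (\<iota> X \<otimes> f) \<cdot> \<Delta> X"
proof -
  have "X \<in> Obj Q"
    using f source_in by (auto simp: hom_def)
  then have "deterministic Q (g \<cdot> f)"
    using gf deterministic_ident by simp
  then have "(g \<otimes> \<iota> Y) \<cdot> \<Delta> Y \<cdot> f = ((g \<cdot> f) \<otimes> f) \<cdot> \<Delta> X"
    using assms(1-3) f g unfolding S_positive_def by blast
  then show ?thesis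
    using gf by simp
qed

theorem proposition7p26:
  fixes Q :: "('o, 'm, 'z) qcd_cat_scheme" (structure)
    and C M :: "('o, 'm) subcat"
    and X Y :: 'o
    and f p q :: 'm
  assumes "quantum_CD_category Q"
    and "S_positive Q C"
    and "M = even_subcat Q"
    and "p \<in> mors M" and "p \<in> hom Q \<I> X" and "unital Q p"
    and "f \<in> mors M" and "f \<in> hom Q X Y" and "unital Q f"
    and "q = f \<cdot> p"
  shows "(invertible Q f \<and> inverse_mor Q f \<in> mors M
            \<longrightarrow> disintegration Q M X Y f p q (inverse_mor Q f)) \<and>
         (f \<in> mors C \<and> p \<in> mors C \<and> invertible Q f \<and> inverse_mor Q f \<in> mors C
            \<longrightarrow> bayesian_inverse Q C X Y f p q (inverse_mor Q f))"
proof -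
  interpret quantum_CD_category Q by fact
  let ?g = "inverse_mor Q f"
  have p: "p \<in> hom Q \<I> X" "grade Q p = 0" and f: "f \<in> hom Q X Y" "grade Q f = 0"
    using assms by (auto simp: unital_def)
  have X: "X \<in> Obj Q" and Y: "Y \<in> Obj Q"
    using f source_in target_in by (auto simp: hom_def)
  have q: "q \<in> hom Q \<I> Y"
    using cmp_in[OF p(1) f(1)] \<open>q = f \<cdot> p\<close> by simp
  have sp: "state_preserving Q X Y f p q"
    using p f q grade_cmp[OF p(1) f(1)] \<open>q = f \<cdot> p\<close> by (simp add: state_preserving_def ehom_def)
  have \<Delta>X: "\<Delta> X \<in> hom Q X (X \<odot> X)" and \<Delta>Y: "\<Delta> Y \<in> hom Q Y (Y \<odot> Y)"
    and iX: "\<iota> X \<in> hom Q X X" "grade Q (\<iota> X) = 0" and iY: "\<iota> Y \<in> hom Q Y Y" "grade Q (\<iota> Y) = 0"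
    using copy_in ident_in X Y by (auto simp: ehom_def)
  show ?thesis
  proof (intro conjI impI; elim conjE)
    assume inv: "invertible Q f" and gM: "?g \<in> mors M"
    note g = inverse_mor[OF inv f(1)]
    have "?g \<cdot> q = p"
      using cmp_assoc[OF p(1) f(1) g(1)] g(2) cmp_ident_left[OF p(1)] \<open>q = f \<cdot> p\<close> by simp
    \<comment> \<open>Composition associates to the left, so the identity on
      \<open>Y \<odot> Y\<close> cancels against \<open>\<Delta> Y\<close> directly.\<close>
    moreover have "(\<iota> Y \<otimes> (f \<cdot> ?g)) \<cdot> \<Delta> Y \<cdot> q = \<Delta> Y \<cdot> q"
      using g(3) Y cmp_ident_left[OF \<Delta>Y] by (simp add: tensor_ident)
    ultimately show "disintegration Q M X Y f p q ?g"
      using sp gM g(1) by (simp add: disintegration_def)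
  next
    assume inv: "invertible Q f" and C: "f \<in> mors C" "?g \<in> mors C"
    note g = inverse_mor[OF inv f(1)]
    \<comment> \<open>Tensors are constrained only for equal grades, so \<open>?g\<close> must be
      known even before it is tensored with \<open>\<iota> Y\<close>.\<close>
    have "grade Q ?g = 0"
      using \<open>S_positive Q C\<close> C(2) by (simp add: S_positive_def)
    then have l: "(?g \<otimes> \<iota> Y) \<cdot> \<Delta> Y \<in> hom Q Y (X \<odot> Y)"
      using cmp_in[OF \<Delta>Y tensor_in[OF g(1) iY(1)]] iY(2) by simp
    \<comment> \<open>Treating the composite typed in \<open>l\<close> as one block, a single use of
      associativity splits q and brings f next to it.\<close>
    have "(?g \<otimes> \<iota> Y) \<cdot> \<Delta> Y \<cdot> q = (?g \<otimes> \<iota> Y) \<cdot> \<Delta> Y \<cdot> f \<cdot> p"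
      using cmp_assoc[OF p(1) f(1) l] \<open>q = f \<cdot> p\<close> by simp
    also have "\<dots> = (\<iota> X \<otimes> f) \<cdot> \<Delta> X \<cdot> p"
      using S_positive_inverse[OF \<open>S_positive Q C\<close> C f(1) g(1,2)] by simp
    finally show "bayesian_inverse Q C X Y f p q ?g"
      using sp C(2) g(1) by (simp add: bayesian_inverse_def)
  qed
qed

end
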